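(* Let $(X,T)$ be a null dynamical system whose set of minimal points is dense in $X$. Then $(X,T)$ is mean equicontinuous.
   Context: A dynamical system $(X,T)$ is a compact metric space $(X,d)$ with a continuous map $T:X\to X$. A point $y$ is minimal if $(\overline{\{T^ky:k\ge0\}},T)$ is a minimal system (every orbit dense). $(X,T)$ is mean equicontinuous if for every $\epsilon>0$ there is $\delta>0$ such that $d(x,y)<\delta$ implies $\limsup_{n\to\infty}\frac1n\sum_{i=0}^{n-1}d(T^ix,T^iy)<\epsilon$. For an increasing sequence $A=\{0\le t_1<t_2<\cdots\}\subseteq\mathbb{Z}_+$ and a finite open cover $\mathcal U$, $h^A_{top}(T,\mathcal U)=\limsup_{n\to\infty}\frac1n\log N(\bigvee_{i=1}^nT^{-t_i}\mathcal U)$, where $N(\cdot)$ is the minimal cardinality of a subcover, and $h^A_{top}(T)=\sup_{\mathcal U}h^A_{top}(T,\mathcal U)$. $(X,T)$ is null if $h^A_{top}(T)=0$ for every increasing sequence $A$. *)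

theory Defs
  imports "HOL-Analysis.Analysis" "HOL-Library.Liminf_Limsup"
begin

definition dyn_system :: "'a::metric_space set \<Rightarrow> ('a \<Rightarrow> 'a) \<Rightarrow> bool" where
  "dyn_system X T \<longleftrightarrow> compact X \<and> continuous_on X T \<and> T ` X \<subseteq> X"

definition orbit :: "('a \<Rightarrow> 'a) \<Rightarrow> 'a \<Rightarrow> 'a set" where
  "orbit T y = range (\<lambda>k. (T ^^ k) y)"

definition minimal_point :: "('a::metric_space \<Rightarrow> 'a) \<Rightarrow> 'a \<Rightarrow> bool" where
  "minimal_point T y \<longleftrightarrow>
     (\<forall>x \<in> closure (orbit T y). closure (orbit T x) = closure (orbit T y))"

definition mean_equicontinuous :: "'a::metric_space set \<Rightarrow> ('a \<Rightarrow> 'a) \<Rightarrow> bool" where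
  "mean_equicontinuous X T \<longleftrightarrow>
     (\<forall>\<epsilon>>0. \<exists>\<delta>>0. \<forall>x\<in>X. \<forall>y\<in>X. dist x y < \<delta> \<longrightarrow>
        limsup (\<lambda>n. ereal ((1 / real n) * (\<Sum>i<n. dist ((T ^^ i) x) ((T ^^ i) y)))) < ereal \<epsilon>)"

definition finite_open_cover :: "'a::topological_space set \<Rightarrow> 'a set set \<Rightarrow> bool" where
  "finite_open_cover X U \<longleftrightarrow> finite U \<and> (\<forall>V\<in>U. openin (top_of_set X) V) \<and> X \<subseteq> \<Union>U"

definition min_subcover :: "'a set \<Rightarrow> 'a set set \<Rightarrow> nat" where
  "min_subcover X V = (LEAST k. \<exists>W \<subseteq> V. finite W \<and> card W = k \<and> X \<subseteq> \<Union>W)"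

text \<open>The join of T^{-t_1}U, ..., T^{-t_n}U (restricted to X); the sequence is t_{i+1} = A i.\<close>
definition join_cover :: "'a set \<Rightarrow> ('a \<Rightarrow> 'a) \<Rightarrow> (nat \<Rightarrow> nat) \<Rightarrow> 'a set set \<Rightarrow> nat \<Rightarrow> 'a set set" where
  "join_cover X T A U n =
     {X \<inter> (\<Inter>i<n. (T ^^ A i) -` f i) | f. \<forall>i<n. f i \<in> U}"

definition seq_entropy_cover :: "'a set \<Rightarrow> ('a \<Rightarrow> 'a) \<Rightarrow> (nat \<Rightarrow> nat) \<Rightarrow> 'a set set \<Rightarrow> ereal" where
  "seq_entropy_cover X T A U =
     limsup (\<lambda>n. ereal (ln (real (min_subcover X (join_cover X T A U n))) / real n))"

definition seq_entropy :: "'a::topological_space set \<Rightarrow> ('a \<Rightarrow> 'a) \<Rightarrow> (nat \<Rightarrow> nat) \<Rightarrow> ereal" where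
  "seq_entropy X T A = (SUP U \<in> {U. finite_open_cover X U}. seq_entropy_cover X T A U)"

definition null_system :: "'a::topological_space set \<Rightarrow> ('a \<Rightarrow> 'a) \<Rightarrow> bool" where
  "null_system X T \<longleftrightarrow> (\<forall>A. strict_mono A \<longrightarrow> seq_entropy X T A = 0)"

end

(* Suppose X is not mean equicontinuous. There are theta > 0 and q such that for all m, G some pair
   (x, y) stays theta-close during [0, m) but is 2*theta-separated during a fraction at least 2/q of
   some later window of length G. Call a time t a one of a pair if its orbits are 2*theta-apart at t,
   and a zero if they are theta-close.

   Let n = q*k. We build times t_1, ..., t_n and pairs whose zero-one patterns along these times are
   pairwise different, one pair at a time. Given finitely many pairs of jointly uniformly recurrent
   points, moving each t_i by a return time tau_i (or by 0) does not change the patterns already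
   realised, and return times occur in every window of some length G. Choose a new pair that is zero
   for a time much longer than G and all t_i, and then has a window of length G with many ones.
   Averaging over shifts of the new pair by a < 2G gives a shift for which at least k of the indices
   i have a return time tau_i moving t_i onto a one, whereas unmoved t_i see a zero. The new pair can
   thus realise any subset of these k indices, in particular a new one as long as there are fewer
   than 2^k old ones. So 2^k pairs are distinguished by q*k times, arbitrarily late, and
   concatenating such sets of times yields a sequence of positive entropy.

   The pairs come from a dense invariant set all of whose finite subsets are jointly uniformly
   recurrent: take a point f of a minimal subset of the product, over all x in X, of the orbit
   closures of x, and then the orbits of f(x) for x minimal. *)
theory Submission
  imports Defs
begin

section \<open>Minimal subsets of compact systems and bounded return gaps\<close>

text \<open>The minimal set is \<open>K - U\<close>; working with its open complement lets Zorn's lemma be used for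
  unions of chains, without separation axioms.\<close>
lemma compact_exists_minimal_invariant:
  fixes F :: "'b::topological_space \<Rightarrow> 'b"
  assumes K: "compact K" "K \<noteq> {}" and inv: "F ` K \<subseteq> K"
  obtains U where "open U" "K - U \<noteq> {}" "F ` (K - U) \<subseteq> K - U"
    "\<And>V. \<lbrakk>open V; U \<subseteq> V; K - V \<noteq> {}; F ` (K - V) \<subseteq> K - V\<rbrakk> \<Longrightarrow> V = U"
proof -
  define \<A> where "\<A> = {U. open U \<and> K - U \<noteq> {} \<and> F ` (K - U) \<subseteq> K - U}"
  have "\<exists>M\<in>\<A>. \<forall>V\<in>\<A>. M \<subseteq> V \<longrightarrow> V = M"
  proof (rule subset_Zorn')
    fix C assume C: "subset.chain \<A> C"
    then have CA: "C \<subseteq> \<A>" by (simp add: subset.chain_def)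
    have "open (\<Union>C)" using CA by (auto simp: \<A>_def)
    moreover have "K - \<Union>C \<noteq> {}"
    proof
      assume "K - \<Union>C = {}"
      moreover have "\<forall>V\<in>C. open V" using CA by (auto simp: \<A>_def)
      ultimately obtain C' where C': "C' \<subseteq> C" "finite C'" "K \<subseteq> \<Union>C'"
        using compactE[OF K(1), of C] by (metis Diff_eq_empty_iff)
      then have "C' \<noteq> {}" using K(2) by auto
      moreover have "subset.chain \<A> C'"
        using C C'(1) unfolding subset.chain_def by blast
      ultimately have "\<Union>C' \<in> C'" using C'(2) Union_in_chain by blast
      then have "\<Union>C' \<in> \<A>" using CA C' by auto
      then show False using C' by (auto simp: \<A>_def)
    qed
    moreover have "F ` (K - \<Union>C) \<subseteq> K - \<Union>C"
    proof
      fix y assume "y \<in> F ` (K - \<Union>C)"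
      then obtain x where x: "x \<in> K" "\<And>V. V \<in> C \<Longrightarrow> x \<notin> V" "y = F x" by auto
      have "y \<notin> V" if "V \<in> C" for V
      proof -
        have "F ` (K - V) \<subseteq> K - V" using CA that by (auto simp: \<A>_def)
        then show ?thesis using x that by blast
      qed
      moreover have "y \<in> K" using x(1,3) inv by auto
      ultimately show "y \<in> K - \<Union>C" by auto
    qed
    ultimately show "\<Union>C \<in> \<A>" by (simp add: \<A>_def)
  qed
  then obtain M where M: "M \<in> \<A>" "\<And>V. V \<in> \<A> \<Longrightarrow> M \<subseteq> V \<Longrightarrow> V = M" by blast
  show ?thesis
  proof (rule that)
    show "open M" "K - M \<noteq> {}" "F ` (K - M) \<subseteq> K - M" using M(1) by (simp_all add: \<A>_def)
    show "V = M" if "open V" "M \<subseteq> V" "K - V \<noteq> {}" "F ` (K - V) \<subseteq> K - V" for V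
      by (rule M(2)) (use that in \<open>simp_all add: \<A>_def\<close>)
  qed
qed

text \<open>The points of \<open>K - U\<close> that never visit \<open>V\<close> form a closed
  invariant set missing \<open>q\<close>, so by minimality there are none. Compactness then bounds
  the first visiting time uniformly over \<open>K - U\<close>, and the bound is applied at
  \<open>(F ^^ b) q\<close>.\<close>

lemma minimal_syndetic_return:
  fixes F :: "'b::topological_space \<Rightarrow> 'b"
  assumes K: "compact K" and cont: "continuous_on K F" and inv: "F ` K \<subseteq> K"
    and U: "open U" "F ` (K - U) \<subseteq> K - U"
    and min: "\<And>V. \<lbrakk>open V; U \<subseteq> V; K - V \<noteq> {}; F ` (K - V) \<subseteq> K - V\<rbrakk> \<Longrightarrow> V = U"
    and V: "open V" and q: "q \<in> K - U" "q \<in> V"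
  obtains G where "\<And>b. \<exists>\<tau>. b \<le> \<tau> \<and> \<tau> < b + G \<and> (F ^^ \<tau>) q \<in> V"
proof -
  have powK: "(F ^^ n) ` K \<subseteq> K" for n
    by (induction n) (use inv in auto)
  have powM: "(F ^^ n) ` (K - U) \<subseteq> K - U" for n
    by (induction n) (use U(2) in auto)
  have cpow: "continuous_on K (F ^^ n)" for n
  proof (induction n)
    case (Suc n)
    have "continuous_on K (F \<circ> F ^^ n)"
      by (rule continuous_on_compose[OF Suc continuous_on_subset[OF cont powK]])
    then show ?case by simp
  qed simp
  \<comment> \<open>\<open>F\<close> is continuous on \<open>K\<close> only, so the preimages of
    \<open>V\<close> are merely relatively open; \<open>W n\<close> is an open set with the same
    trace on \<open>K\<close>.\<close>
  have "\<exists>W. open W \<and> W \<inter> K = (F ^^ n) -` V \<inter> K" for n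
    using continuous_on_open_invariant[THEN iffD1, OF cpow, rule_format, OF V] .
  then obtain W where W: "\<And>n. open (W n)" "\<And>n. W n \<inter> K = (F ^^ n) -` V \<inter> K"
    by metis
  define Y where "Y = U \<union> (\<Union>n. W n)"
  have KY: "x \<in> K - Y \<longleftrightarrow> x \<in> K - U \<and> (\<forall>n. (F ^^ n) x \<notin> V)" for x
    using W(2) by (auto simp: Y_def)
  have "K \<subseteq> Y"
  proof (rule ccontr)
    assume "\<not> K \<subseteq> Y"
    moreover have "F ` (K - Y) \<subseteq> K - Y"
    proof
      fix y assume "y \<in> F ` (K - Y)"
      then obtain x where x: "x \<in> K - U" "\<forall>n. (F ^^ n) x \<notin> V" and y: "y = F x"
        using KY by auto
      have "(F ^^ n) y \<notin> V" for n
        using x(2)[rule_format, of "Suc n"] y by (simp add: funpow_swap1)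
      then show "y \<in> K - Y" using x(1) y U(2) KY by blast
    qed
    moreover have "open Y" using U(1) W(1) by (auto simp: Y_def)
    moreover have "U \<subseteq> Y" by (auto simp: Y_def)
    ultimately have "Y = U" using min by blast
    moreover have "q \<notin> K - Y" using KY[of q] q(2) by (metis funpow_0)
    ultimately show False using q(1) by simp
  qed
  then have "K - U \<subseteq> (\<Union>n. W n)" by (auto simp: Y_def)
  moreover have "compact (K - U)" using K U(1) by (simp add: compact_diff)
  ultimately obtain N where N: "finite N" "K - U \<subseteq> (\<Union>n\<in>N. W n)"
    using compactE_image[of "K - U" UNIV W] W(1) by auto
  obtain G where G: "\<And>n. n \<in> N \<Longrightarrow> n < G"
    using finite_nat_set_iff_bounded[THEN iffD1, OF N(1)] by blast
  show ?thesis
  proof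
    fix b
    have "(F ^^ b) q \<in> K - U" using powM q(1) by blast
    then obtain n where n: "n \<in> N" "(F ^^ b) q \<in> W n \<inter> K" using N(2) by blast
    then have "(F ^^ n) ((F ^^ b) q) \<in> V" using W(2) by blast
    then have "(F ^^ (b + n)) q \<in> V" by (simp add: funpow_add add.commute[of b])
    then show "\<exists>\<tau>. b \<le> \<tau> \<and> \<tau> < b + G \<and> (F ^^ \<tau>) q \<in> V"
      using G[OF n(1)] by (intro exI[of _ "b + n"]) simp
  qed
qed

section \<open>Iterates and orbit closures\<close>

lemma funpow_commute: "(T ^^ a) ((T ^^ b) x) = (T ^^ b) ((T ^^ a) x)"
  by (metis add.commute comp_apply funpow_add)

lemma funpow_invariant:
  assumes "T ` X \<subseteq> X" "x \<in> X"
  shows "(T ^^ n) x \<in> X"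
  using assms by (induction n) auto

lemma continuous_on_funpow:
  assumes "continuous_on X T" "T ` X \<subseteq> X"
  shows "continuous_on X (T ^^ n)"
proof (induction n)
  case (Suc n)
  have "(T ^^ n) ` X \<subseteq> X" using assms(2) funpow_invariant by (metis image_subsetI)
  then have "continuous_on X (T \<circ> T ^^ n)"
    by (intro continuous_on_compose Suc continuous_on_subset[OF assms(1)])
  then show ?case by simp
qed simp

lemma orbit_closure:
  assumes "dyn_system X T" "x \<in> X"
  shows "closure (orbit T x) \<subseteq> X" "compact (closure (orbit T x))"
    "T ` closure (orbit T x) \<subseteq> closure (orbit T x)" "x \<in> closure (orbit T x)"
proof -
  have X: "compact X" "continuous_on X T" "T ` X \<subseteq> X"
    using assms(1) by (auto simp: dyn_system_def)
  have "orbit T x \<subseteq> X" using funpow_invariant[OF X(3) assms(2)] by (auto simp: orbit_def)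
  then show sub: "closure (orbit T x) \<subseteq> X"
    by (simp add: closure_minimal compact_imp_closed X(1))
  have "closure (orbit T x) = X \<inter> closure (orbit T x)" using sub by auto
  then show "compact (closure (orbit T x))" using X(1) by (metis closed_closure compact_Int_closed)
  have "T ` orbit T x \<subseteq> orbit T x"
    by (auto simp: orbit_def intro: range_eqI[where x = "Suc _"])
  then have "T ` orbit T x \<subseteq> closure (orbit T x)" using closure_subset by blast
  then show "T ` closure (orbit T x) \<subseteq> closure (orbit T x)"
    by (intro image_closure_subset continuous_on_subset[OF X(2) sub]) auto
  have "x \<in> orbit T x" unfolding orbit_def by (rule range_eqI[of _ _ 0]) simp
  then show "x \<in> closure (orbit T x)" using closure_subset by blast
qed

section \<open>A dense invariant set of jointly recurrent points\<close>

text \<open>Tychonoff's theorem, transferred to the topology of the function type.\<close>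

lemma compact_PiE_UNIV:
  assumes "\<And>i. compact (C i)"
  shows "compact (PiE UNIV C)"
  using compactin_PiE[of "\<lambda>_. euclidean" UNIV C] assms
  by (simp add: euclidean_product_topology)

text \<open>For finite \<open>E\<close> this is uniform recurrence of the tuple of its points under
  the product map: \<open>G\<close> is chosen before \<open>b\<close>, so the common return times
  have bounded gaps.\<close>

definition jointly_recurrent :: "('a::metric_space \<Rightarrow> 'a) \<Rightarrow> 'a set \<Rightarrow> bool" where
  "jointly_recurrent T E \<longleftrightarrow>
     (\<forall>\<eta>>0. \<exists>G. \<forall>b. \<exists>\<tau>. b \<le> \<tau> \<and> \<tau> < b + G \<and> (\<forall>x\<in>E. dist ((T ^^ \<tau>) x) x < \<eta>))"

text \<open>Individually minimal points need not return together, so \<open>Q\<close> is built from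
  a single point \<open>q\<close> of a minimal set in the product of orbit closures. A finite part
  of \<open>Q\<close> involves finitely many coordinates of \<open>q\<close>, so its common returns
  come from returns of \<open>q\<close> to one open set. If \<open>y\<close> is minimal, then
  \<open>q y\<close> has the same orbit closure as \<open>y\<close>, so the orbit of
  \<open>q y\<close> comes arbitrarily close to \<open>y\<close>.\<close>

lemma dense_jointly_recurrent:
  fixes X :: "'a::metric_space set"
  assumes dyn: "dyn_system X T" and dense: "X \<subseteq> closure {y \<in> X. minimal_point T y}"
  obtains Q where "Q \<subseteq> X" "T ` Q \<subseteq> Q" "X \<subseteq> closure Q"
    "\<forall>E\<subseteq>Q. finite E \<longrightarrow> jointly_recurrent T E"
proof (cases "X = {}")
  case True
  have "jointly_recurrent T {}"
    unfolding jointly_recurrent_def by (intro allI impI, rule exI[of _ 1]) auto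
  then show ?thesis using True by (intro that[of "{}"]) auto
next
  case False
  then obtain x0 where x0: "x0 \<in> X" by auto
  have X: "compact X" "continuous_on X T" "T ` X \<subseteq> X"
    using dyn by (auto simp: dyn_system_def)
  \<comment> \<open>The coordinates are indexed by the whole type; outside \<open>X\<close> the
    default \<open>x0\<close> keeps every factor a nonempty compact subset of
    \<open>X\<close>.\<close>
  define f0 where "f0 x = (if x \<in> X then x else x0)" for x
  define C where "C x = closure (orbit T (f0 x))" for x
  have f0: "f0 x \<in> X" for x using x0 by (simp add: f0_def)
  note C = orbit_closure[OF dyn f0, folded C_def]
  define K where "K = PiE UNIV C"
  define F where "F f = T \<circ> f" for f :: "'a \<Rightarrow> 'a"
  have Fpow: "(F ^^ n) f = (T ^^ n) \<circ> f" for n f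
    by (induction n) (auto simp: F_def)
  have KC: "f \<in> K \<Longrightarrow> f x \<in> C x" for f x by (auto simp: K_def)
  have KX: "f \<in> K \<Longrightarrow> f x \<in> X" for f x using KC C(1) by blast
  have compK: "compact K" unfolding K_def by (rule compact_PiE_UNIV) (rule C)
  have "f0 \<in> K" using C(4) by (auto simp: K_def)
  then have neK: "K \<noteq> {}" by auto
  have "F f \<in> K" if "f \<in> K" for f
    using C(3)[THEN subsetD, OF imageI, OF KC[OF that]] by (simp add: K_def F_def PiE_def)
  then have inv: "F ` K \<subseteq> K" by blast
  have coord: "continuous_on K (\<lambda>f. f x)" for x
    by (rule continuous_on_subset[OF continuous_on_product_coordinates]) simp
  have cpow: "continuous_on K (\<lambda>f. (T ^^ n) (f x))" for n x
    by (rule continuous_on_compose2[OF continuous_on_funpow[OF X(2,3)] coord]) (use KX in auto)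
  have contF: "continuous_on K F"
    unfolding F_def by (rule continuous_on_coordinatewise_then_product) (use cpow[of 1] in simp)
  obtain U where U: "open U" "K - U \<noteq> {}" "F ` (K - U) \<subseteq> K - U"
    and min: "\<And>V. \<lbrakk>open V; U \<subseteq> V; K - V \<noteq> {}; F ` (K - V) \<subseteq> K - V\<rbrakk> \<Longrightarrow> V = U"
    using compact_exists_minimal_invariant[OF compK neK inv] by blast
  obtain q where q: "q \<in> K - U" using U(2) by auto
  then have qK: "q \<in> K" by simp
  define Q where "Q = {(T ^^ a) (q x) |a x. True}"
  show ?thesis
  proof
    show "Q \<subseteq> X" using funpow_invariant[OF X(3) KX[OF qK]] by (auto simp: Q_def)
    show "T ` Q \<subseteq> Q"
    proof
      fix y assume "y \<in> T ` Q"
      then obtain a x where "y = T ((T ^^ a) (q x))" by (auto simp: Q_def)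
      then have "y = (T ^^ Suc a) (q x)" by simp
      then show "y \<in> Q" unfolding Q_def by blast
    qed
    have "y \<in> closure Q" if y: "y \<in> X" "minimal_point T y" for y
    proof -
      have "q y \<in> closure (orbit T y)" using KC[OF qK, of y] y(1) by (simp add: C_def f0_def)
      then have "closure (orbit T (q y)) = closure (orbit T y)"
        using y(2) by (simp add: minimal_point_def)
      then have "y \<in> closure (orbit T (q y))" using orbit_closure(4)[OF dyn y(1)] by simp
      moreover have "orbit T (q y) \<subseteq> Q" by (auto simp: Q_def orbit_def)
      ultimately show ?thesis using closure_mono by blast
    qed
    then have "closure {y \<in> X. minimal_point T y} \<subseteq> closure Q"
      by (intro closure_minimal) auto
    then show "X \<subseteq> closure Q" using dense by blast
  next
    show "\<forall>E\<subseteq>Q. finite E \<longrightarrow> jointly_recurrent T E"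
    proof (intro allI impI)
      fix E assume E: "E \<subseteq> Q" "finite E"
      then have "\<forall>e\<in>E. \<exists>a x. e = (T ^^ a) (q x)" by (auto simp: Q_def)
      then obtain a x where ax: "\<And>e. e \<in> E \<Longrightarrow> e = (T ^^ a e) (q (x e))" by metis
      show "jointly_recurrent T E"
        unfolding jointly_recurrent_def
      proof (intro allI impI)
        fix \<eta> :: real assume \<eta>: "\<eta> > 0"
        \<comment> \<open>Each \<open>e\<close> is an iterate of a coordinate of \<open>q\<close>;
          that this iterated coordinate of \<open>f\<close> is near \<open>e\<close> is an open
          condition on \<open>f\<close> in \<open>K\<close>.\<close>
        have "\<exists>V. open V \<and> V \<inter> K = (\<lambda>f. (T ^^ a e) (f (x e))) -` ball e \<eta> \<inter> K" for e
          using continuous_on_open_invariant[THEN iffD1, OF cpow, rule_format, OF open_ball] .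
        then obtain V where V: "\<And>e. open (V e)"
          "\<And>e. V e \<inter> K = (\<lambda>f. (T ^^ a e) (f (x e))) -` ball e \<eta> \<inter> K" by metis
        have "q \<in> V e" if "e \<in> E" for e
        proof -
          have "(T ^^ a e) (q (x e)) \<in> ball e \<eta>" using ax[OF that] \<eta> by simp
          then show ?thesis using V(2)[of e] qK by blast
        qed
        then have "q \<in> (\<Inter>e\<in>E. V e)" by auto
        moreover have "open (\<Inter>e\<in>E. V e)" using V(1) E(2) by (intro open_INT) auto
        ultimately obtain G where
          G: "\<And>b. \<exists>\<tau>. b \<le> \<tau> \<and> \<tau> < b + G \<and> (F ^^ \<tau>) q \<in> (\<Inter>e\<in>E. V e)"
          using minimal_syndetic_return[OF compK contF inv U(1,3) min _ q, of "\<Inter>e\<in>E. V e"] by blast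
        have "dist ((T ^^ \<tau>) e) e < \<eta>" if "e \<in> E" "(F ^^ \<tau>) q \<in> (\<Inter>e\<in>E. V e)" for e \<tau>
        proof -
          have "(F ^^ \<tau>) q \<in> K" using funpow_invariant[OF inv qK] .
          then have "(T ^^ a e) ((F ^^ \<tau>) q (x e)) \<in> ball e \<eta>" using V(2)[of e] that by blast
          moreover have "(T ^^ a e) ((F ^^ \<tau>) q (x e)) = (T ^^ \<tau>) ((T ^^ a e) (q (x e)))"
            by (simp add: Fpow funpow_commute)
          ultimately show ?thesis using ax[OF that(1)] by (simp add: dist_commute)
        qed
        then show "\<exists>G. \<forall>b. \<exists>\<tau>\<ge>b. \<tau> < b + G \<and> (\<forall>x\<in>E. dist ((T ^^ \<tau>) x) x < \<eta>)"
          using G by meson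
      qed
    qed
  qed
qed

section \<open>Orbit averages when mean equicontinuity fails\<close>

text \<open>An initial segment of length \<open>n\<close> is covered by \<open>Suc (n div G)\<close>
  consecutive blocks; the overshoot costs at most \<open>c * G\<close>, which vanishes after
  division by \<open>n\<close>.\<close>

lemma limsup_average_le_of_blocks:
  fixes f :: "nat \<Rightarrow> real"
  assumes f: "\<And>i. 0 \<le> f i" and G: "G > 0"
    and block: "\<And>b. (\<Sum>i\<in>{b..<b + G}. f i) \<le> c * real G"
  shows "limsup (\<lambda>n. ereal ((1 / real n) * (\<Sum>i<n. f i))) \<le> ereal c"
proof -
  have "0 \<le> (\<Sum>i\<in>{0..<0 + G}. f i)" by (rule sum_nonneg) (rule f)
  then have "0 \<le> c * real G" using block[of 0] by linarith
  then have c: "0 \<le> c" using G by (simp add: zero_le_mult_iff)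
  have mult: "(\<Sum>i<k * G. f i) \<le> c * real (k * G)" for k
  proof (induction k)
    case (Suc k)
    have "(\<Sum>i<Suc k * G. f i) = (\<Sum>i<k * G. f i) + (\<Sum>i\<in>{k * G..<k * G + G}. f i)"
      by (simp add: add.commute lessThan_atLeast0 sum.atLeastLessThan_concat)
    also have "\<dots> \<le> c * real (k * G) + c * real G" using Suc block by (intro add_mono)
    finally show ?case by (simp add: algebra_simps)
  qed simp
  have le: "(1 / real n) * (\<Sum>i<n. f i) \<le> c + c * real G / real n" if "n > 0" for n
  proof -
    have "n \<le> Suc (n div G) * G" using dividend_less_div_times[OF G, of n] by simp
    then have "(\<Sum>i<n. f i) \<le> (\<Sum>i<Suc (n div G) * G. f i)"
      using f by (intro sum_mono2) auto
    also have "\<dots> \<le> c * real (Suc (n div G) * G)" by (rule mult)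
    also have "\<dots> \<le> c * real (n + G)"
      using c by (intro mult_left_mono) (simp_all add: flip: of_nat_mult of_nat_add)
    finally have "(1 / real n) * (\<Sum>i<n. f i) \<le> (1 / real n) * (c * real (n + G))"
      by (intro mult_left_mono) auto
    then show ?thesis using that by (simp add: field_simps)
  qed
  have "(\<lambda>n. c + c * real G / real n) \<longlonglongrightarrow> c + 0"
    by (intro tendsto_intros lim_const_over_n)
  then have lim: "(\<lambda>n. ereal (c + c * real G / real n)) \<longlonglongrightarrow> ereal c" by simp
  have "limsup (\<lambda>n. ereal ((1 / real n) * (\<Sum>i<n. f i)))
      \<le> limsup (\<lambda>n. ereal (c + c * real G / real n))"
    by (intro Limsup_mono eventually_mono[OF eventually_gt_at_top[of 0]]) (use le in simp)
  also have "\<dots> = ereal c" using lim by (intro lim_imp_Limsup) auto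
  finally show ?thesis .
qed

text \<open>The iterates below \<open>L\<close> are finitely many uniformly continuous maps on the
  compact \<open>X\<close>, so one \<delta> serves them all.\<close>

lemma finite_time_shadowing:
  fixes X :: "'a::metric_space set"
  assumes dyn: "dyn_system X T" and \<rho>: "\<rho> > 0"
  obtains \<delta> where "\<delta> > 0"
    "\<And>x y t. \<lbrakk>x \<in> X; y \<in> X; dist x y < \<delta>; t < L\<rbrakk> \<Longrightarrow> dist ((T ^^ t) x) ((T ^^ t) y) < \<rho>"
proof -
  have "\<exists>\<delta>>0. \<forall>x\<in>X. \<forall>y\<in>X. dist x y < \<delta> \<longrightarrow> (\<forall>t<L. dist ((T ^^ t) x) ((T ^^ t) y) < \<rho>)"
  proof (induction L)
    case 0
    show ?case by (rule exI[of _ 1]) simp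
  next
    case (Suc L)
    then obtain \<delta> where \<delta>: "\<delta> > 0"
      "\<forall>x\<in>X. \<forall>y\<in>X. dist x y < \<delta> \<longrightarrow> (\<forall>t<L. dist ((T ^^ t) x) ((T ^^ t) y) < \<rho>)" by blast
    have "uniformly_continuous_on X (T ^^ L)"
      using dyn by (intro compact_uniformly_continuous continuous_on_funpow)
        (auto simp: dyn_system_def)
    then obtain \<delta>' where \<delta>': "\<delta>' > 0"
      "\<forall>x\<in>X. \<forall>y\<in>X. dist y x < \<delta>' \<longrightarrow> dist ((T ^^ L) y) ((T ^^ L) x) < \<rho>"
      using \<rho> unfolding uniformly_continuous_on_def by blast
    show ?case
      using \<delta> \<delta>' by (intro exI[of _ "min \<delta> \<delta>'"]) (auto simp: less_Suc_eq)
  qed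
  then show ?thesis using that by blast
qed

lemma abs_dist_diff_le:
  fixes a b a' b' :: "'a::metric_space"
  shows "\<bar>dist a b - dist a' b'\<bar> \<le> dist a a' + dist b b'"
proof -
  have "dist a b \<le> dist a a' + (dist a' b' + dist b' b)"
    by (meson add_left_mono dist_triangle order_trans)
  moreover have "dist a' b' \<le> dist a' a + (dist a b + dist b b')"
    by (meson add_left_mono dist_triangle order_trans)
  ultimately show ?thesis using dist_commute[of a' a] dist_commute[of b' b] by linarith
qed

text \<open>Some arbitrarily close points have upper mean distance at least \<epsilon>, hence a
  block of length \<open>G\<close> with mean above \<epsilon>/2. Distances are bounded, so a fixed
  fraction of that block must be separated. Approximating over a finite horizon moves the pair into
  \<open>Q\<close>.\<close>

lemma not_mean_equicontinuous_blocks: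
  fixes X :: "'a::metric_space set"
  assumes dyn: "dyn_system X T" and Q: "Q \<subseteq> X" "X \<subseteq> closure Q"
    and not_me: "\<not> mean_equicontinuous X T"
  obtains \<theta> :: real and q :: nat where "\<theta> > 0"
    "\<forall>m. \<forall>G>0. \<exists>x\<in>Q. \<exists>y\<in>Q. (\<forall>t<m. dist ((T ^^ t) x) ((T ^^ t) y) < \<theta>) \<and>
       (\<exists>b. 2 * G \<le> q * card {t \<in> {b..<b + G}. 2 * \<theta> < dist ((T ^^ t) x) ((T ^^ t) y)})"
proof -
  have X: "compact X" "T ` X \<subseteq> X" using dyn by (auto simp: dyn_system_def)
  obtain \<epsilon> where \<epsilon>: "\<epsilon> > 0" and bad: "\<And>\<delta>. \<delta> > 0 \<Longrightarrow> \<exists>x\<in>X. \<exists>y\<in>X. dist x y < \<delta> \<and>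
      \<not> limsup (\<lambda>n. ereal ((1 / real n) * (\<Sum>i<n. dist ((T ^^ i) x) ((T ^^ i) y)))) < ereal \<epsilon>"
    using not_me unfolding mean_equicontinuous_def by blast
  \<comment> \<open>The block mean then exceeds 4\<theta>. Passing to \<open>Q\<close> loses at most
    \<theta>/2 and the unseparated times account for at most 2\<theta>, so more than \<theta> is
    left for the separated ones.\<close>
  define \<theta> where "\<theta> = \<epsilon> / 8"
  have \<theta>: "\<theta> > 0" using \<epsilon> by (simp add: \<theta>_def)
  define D where "D = diameter X + 1"
  have D: "dist x y \<le> D" if "x \<in> X" "y \<in> X" for x y
    using diameter_bounded_bound[OF compact_imp_bounded[OF X(1)] that] by (simp add: D_def)
  have "D > 0" using diameter_ge_0[OF compact_imp_bounded[OF X(1)]] by (simp add: D_def)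
  \<comment> \<open>\<open>q\<close> depends only on \<theta> and the diameter, hence is uniform in
    \<open>m\<close> and \<open>G\<close>.\<close>
  obtain q :: nat where q: "2 * D / \<theta> \<le> real q" using real_arch_simple by blast
  show ?thesis
  proof (rule that[of \<theta> q, OF \<theta>], intro allI impI)
    fix m G :: nat assume G: "G > 0"
    obtain \<delta> where \<delta>: "\<delta> > 0" "\<And>x y t. \<lbrakk>x \<in> X; y \<in> X; dist x y < \<delta>; t < m\<rbrakk> \<Longrightarrow>
        dist ((T ^^ t) x) ((T ^^ t) y) < \<theta> / 2"
      using finite_time_shadowing[OF dyn, of "\<theta> / 2" m] \<theta> by auto
    obtain x y where xy: "x \<in> X" "y \<in> X" "dist x y < \<delta>"
      and ls: "\<not> limsup (\<lambda>n. ereal ((1 / real n) * (\<Sum>i<n. dist ((T ^^ i) x) ((T ^^ i) y)))) < ereal \<epsilon>"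
      using bad[OF \<delta>(1)] by blast
    have "\<exists>b. \<epsilon> / 2 * real G < (\<Sum>i\<in>{b..<b + G}. dist ((T ^^ i) x) ((T ^^ i) y))"
    proof (rule ccontr)
      assume "\<not> ?thesis"
      then have "limsup (\<lambda>n. ereal ((1 / real n) * (\<Sum>i<n. dist ((T ^^ i) x) ((T ^^ i) y))))
          \<le> ereal (\<epsilon> / 2)"
        by (intro limsup_average_le_of_blocks[OF _ G]) (auto simp: not_less)
      also have "\<dots> < ereal \<epsilon>" using \<epsilon> by simp
      finally show False using ls by blast
    qed
    then obtain b where b: "\<epsilon> / 2 * real G < (\<Sum>i\<in>{b..<b + G}. dist ((T ^^ i) x) ((T ^^ i) y))"
      by blast
    \<comment> \<open>The horizon must reach the end of the block, so this radius can be chosen only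
      after \<open>b\<close>.\<close>
    obtain \<delta>' where \<delta>': "\<delta>' > 0" "\<And>x y t. \<lbrakk>x \<in> X; y \<in> X; dist x y < \<delta>'; t < m + b + G\<rbrakk> \<Longrightarrow>
        dist ((T ^^ t) x) ((T ^^ t) y) < \<theta> / 4"
      using finite_time_shadowing[OF dyn, of "\<theta> / 4" "m + b + G"] \<theta> by auto
    obtain x' y' where x': "x' \<in> Q" "dist x' x < \<delta>'" and y': "y' \<in> Q" "dist y' y < \<delta>'"
      using xy Q(2) \<delta>'(1) closure_approachable[of _ Q] by (meson subsetD)
    have near: "\<bar>dist ((T ^^ t) x') ((T ^^ t) y') - dist ((T ^^ t) x) ((T ^^ t) y)\<bar> \<le> \<theta> / 2"
      if "t < m + b + G" for t
      using abs_dist_diff_le[of "(T ^^ t) x'" "(T ^^ t) y'" "(T ^^ t) x" "(T ^^ t) y"]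
        \<delta>'(2)[of x' x t] \<delta>'(2)[of y' y t] x' y' xy(1,2) subsetD[OF Q(1) x'(1)] subsetD[OF Q(1) y'(1)] that by auto
    have "dist ((T ^^ t) x') ((T ^^ t) y') < \<theta>" if "t < m" for t
      using near[of t] \<delta>(2)[OF xy that] that by linarith
    moreover have "2 * G \<le> q * card {t \<in> {b..<b + G}. 2 * \<theta> < dist ((T ^^ t) x') ((T ^^ t) y')}"
    proof -
      let ?g = "\<lambda>t. dist ((T ^^ t) x') ((T ^^ t) y')"
      let ?E = "{t \<in> {b..<b + G}. 2 * \<theta> < ?g t}"
      have "(\<Sum>t\<in>{b..<b + G}. dist ((T ^^ t) x) ((T ^^ t) y) - \<theta> / 2) \<le> (\<Sum>t\<in>{b..<b + G}. ?g t)"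
      proof (rule sum_mono)
        fix t assume "t \<in> {b..<b + G}"
        then have "t < m + b + G" by simp
        then show "dist ((T ^^ t) x) ((T ^^ t) y) - \<theta> / 2 \<le> ?g t" using near[of t] by linarith
      qed
      then have "\<epsilon> / 2 * real G - \<theta> / 2 * real G < (\<Sum>t\<in>{b..<b + G}. ?g t)"
        using b by (simp add: sum_subtractf algebra_simps)
      also have "(\<Sum>t\<in>{b..<b + G}. ?g t) \<le> (\<Sum>t\<in>{b..<b + G}. 2 * \<theta> + (if 2 * \<theta> < ?g t then D else 0))"
      proof (rule sum_mono)
        fix t
        have "?g t \<le> D" using funpow_invariant[OF X(2)] x'(1) y'(1) Q(1) by (intro D) auto
        then show "?g t \<le> 2 * \<theta> + (if 2 * \<theta> < ?g t then D else 0)" using \<theta> by auto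
      qed
      also have "\<dots> = 2 * \<theta> * real G + D * real (card ?E)"
        by (simp add: sum.distrib sum.If_cases Int_def mult.commute)
      finally have "4 * (\<theta> * real G) - (\<theta> * real G) / 2 < 2 * (\<theta> * real G) + D * real (card ?E)"
        by (simp add: \<theta>_def)
      moreover have "0 \<le> \<theta> * real G" using \<theta> by simp
      ultimately have "\<theta> * real G \<le> D * real (card ?E)" by linarith
      then have "2 * real G \<le> 2 * D / \<theta> * real (card ?E)" using \<theta> by (simp add: field_simps)
      also have "\<dots> \<le> real q * real (card ?E)" using q by (intro mult_right_mono) auto
      finally show ?thesis by (simp flip: of_nat_mult of_nat_le_iff)
    qed
    ultimately show "\<exists>x\<in>Q. \<exists>y\<in>Q. (\<forall>t<m. dist ((T ^^ t) x) ((T ^^ t) y) < \<theta>) \<and>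
       (\<exists>b. 2 * G \<le> q * card {t \<in> {b..<b + G}. 2 * \<theta> < dist ((T ^^ t) x) ((T ^^ t) y)})"
      using x'(1) y'(1) by blast
  qed
qed

section \<open>Sequence entropy bounded below by separated pairs\<close>

text \<open>The join is finite and covers \<open>X\<close>, so it is a finite subcover of itself and
  the \<open>LEAST\<close> in \<open>min_subcover\<close> is attained.\<close>

lemma min_subcover_attained:
  assumes dyn: "dyn_system X T" and U: "finite_open_cover X U"
  obtains W where "W \<subseteq> join_cover X T A U n" "finite W"
    "card W = min_subcover X (join_cover X T A U n)" "X \<subseteq> \<Union>W"
proof -
  let ?J = "join_cover X T A U n"
  have X: "T ` X \<subseteq> X" using dyn by (auto simp: dyn_system_def)
  have U': "finite U" "X \<subseteq> \<Union>U" using U by (auto simp: finite_open_cover_def)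
  \<comment> \<open>There may be infinitely many choice functions on \<open>nat\<close>, but a
    member of the join depends only on the values below \<open>n\<close>.\<close>
  have "?J \<subseteq> (\<lambda>f. X \<inter> (\<Inter>i<n. (T ^^ A i) -` f i)) ` PiE {..<n} (\<lambda>_. U)"
  proof
    fix J assume "J \<in> ?J"
    then obtain f where f: "\<forall>i<n. f i \<in> U" "J = X \<inter> (\<Inter>i<n. (T ^^ A i) -` f i)"
      by (auto simp: join_cover_def)
    then have "J = X \<inter> (\<Inter>i<n. (T ^^ A i) -` (restrict f {..<n}) i)" by auto
    moreover have "restrict f {..<n} \<in> PiE {..<n} (\<lambda>_. U)" using f(1) by auto
    ultimately show "J \<in> (\<lambda>f. X \<inter> (\<Inter>i<n. (T ^^ A i) -` f i)) ` PiE {..<n} (\<lambda>_. U)" by blast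
  qed
  then have fin: "finite ?J"
    by (rule finite_subset) (intro finite_imageI finite_PiE, use U'(1) in auto)
  have "X \<subseteq> \<Union>?J"
  proof
    fix x assume x: "x \<in> X"
    then have "\<forall>i. \<exists>V\<in>U. (T ^^ A i) x \<in> V" using funpow_invariant[OF X] U'(2) by blast
    then obtain f where "\<And>i. f i \<in> U" "\<And>i. (T ^^ A i) x \<in> f i" by metis
    then have "x \<in> X \<inter> (\<Inter>i<n. (T ^^ A i) -` f i)" "\<forall>i<n. f i \<in> U" using x by auto
    then show "x \<in> \<Union>?J" unfolding join_cover_def by blast
  qed
  then have "\<exists>W\<subseteq>?J. finite W \<and> card W = card ?J \<and> X \<subseteq> \<Union>W" using fin by blast
  then have "\<exists>W\<subseteq>?J. finite W \<and> card W = min_subcover X ?J \<and> X \<subseteq> \<Union>W"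
    unfolding min_subcover_def by (rule LeastI)
  then show ?thesis using that by blast
qed


text \<open>Send a pair to the two members of a minimal subcover chosen for its coordinates. Pairs
  with the same image have coordinates \<theta>/2-close at every observed time, so their distances
  differ by less than \<theta>. The map is therefore injective into \<open>W \<times> W\<close>,
  whence the square.\<close>

lemma card_separated_pairs_le:
  fixes X :: "'a::metric_space set"
  assumes dyn: "dyn_system X T" and U: "finite_open_cover X U"
    and small: "\<And>V x y. \<lbrakk>V \<in> U; x \<in> V; y \<in> V\<rbrakk> \<Longrightarrow> dist x y < \<theta> / 2"
    and P: "P \<subseteq> X \<times> X"
    and sep: "\<And>p p'. \<lbrakk>p \<in> P; p' \<in> P; p \<noteq> p'\<rbrakk> \<Longrightarrow> \<exists>t\<in>A ` {..<n}.
      \<theta> \<le> \<bar>dist ((T ^^ t) (fst p)) ((T ^^ t) (snd p)) - dist ((T ^^ t) (fst p')) ((T ^^ t) (snd p'))\<bar>"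
  shows "card P \<le> (min_subcover X (join_cover X T A U n))\<^sup>2"
proof -
  obtain W where W: "W \<subseteq> join_cover X T A U n" "finite W"
    "card W = min_subcover X (join_cover X T A U n)" "X \<subseteq> \<Union>W"
    by (rule min_subcover_attained[OF dyn U])
  have "\<forall>x\<in>X. \<exists>w\<in>W. x \<in> w" using W(4) by blast
  then obtain c where c: "\<And>x. x \<in> X \<Longrightarrow> c x \<in> W" "\<And>x. x \<in> X \<Longrightarrow> x \<in> c x" by metis
  have close: "dist ((T ^^ t) x) ((T ^^ t) x') < \<theta> / 2"
    if h: "x \<in> X" "x' \<in> X" "c x = c x'" "t \<in> A ` {..<n}" for x x' t
  proof -
    obtain i where i: "i < n" "t = A i" using h(4) by auto
    have "c x \<in> join_cover X T A U n" using c(1) W(1) h(1) by blast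
    then obtain f where f: "\<forall>i<n. f i \<in> U" "c x = X \<inter> (\<Inter>i<n. (T ^^ A i) -` f i)"
      by (auto simp: join_cover_def)
    have "(T ^^ A i) x \<in> f i" using c(2)[OF h(1)] f(2) i(1) by auto
    moreover have "(T ^^ A i) x' \<in> f i" using c(2)[OF h(2)] f(2) i(1) h(3) by auto
    ultimately show ?thesis using small f(1) i by blast
  qed
  have "inj_on (map_prod c c) P"
  proof (rule inj_onI, rule ccontr)
    fix p p' assume p: "p \<in> P" "p' \<in> P" "map_prod c c p = map_prod c c p'" "p \<noteq> p'"
    obtain x y x' y' where e: "p = (x, y)" "p' = (x', y')" by fastforce
    have in_X: "x \<in> X" "y \<in> X" "x' \<in> X" "y' \<in> X" using p(1,2) P e by auto
    obtain t where t: "t \<in> A ` {..<n}"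
      "\<theta> \<le> \<bar>dist ((T ^^ t) x) ((T ^^ t) y) - dist ((T ^^ t) x') ((T ^^ t) y')\<bar>"
      using sep[OF p(1,2,4)] e by auto
    have "dist ((T ^^ t) x) ((T ^^ t) x') < \<theta> / 2" "dist ((T ^^ t) y) ((T ^^ t) y') < \<theta> / 2"
      using close in_X t(1) p(3) e by auto
    then show False
      using t(2) abs_dist_diff_le[of "(T ^^ t) x" "(T ^^ t) y" "(T ^^ t) x'" "(T ^^ t) y'"]
      by linarith
  qed
  moreover have "map_prod c c ` P \<subseteq> W \<times> W" using c(1) P by fastforce
  ultimately have "card P \<le> card (W \<times> W)" using W(2) by (intro card_inj_on_le) auto
  then show ?thesis by (simp add: card_cartesian_product W(3) power2_eq_square)
qed

lemma exists_fine_finite_open_cover: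
  fixes X :: "'a::metric_space set"
  assumes "compact X" "\<epsilon> > 0"
  obtains U where "finite_open_cover X U" "\<And>V x y. \<lbrakk>V \<in> U; x \<in> V; y \<in> V\<rbrakk> \<Longrightarrow> dist x y < \<epsilon>"
proof -
  have "X \<subseteq> (\<Union>x\<in>X. ball x (\<epsilon> / 2))" using assms(2) by auto
  then obtain D where D: "D \<subseteq> X" "finite D" "X \<subseteq> (\<Union>x\<in>D. ball x (\<epsilon> / 2))"
    using compactE_image[OF assms(1), of X "\<lambda>x. ball x (\<epsilon> / 2)"] by auto
  show ?thesis
  proof
    show "finite_open_cover X ((\<lambda>z. X \<inter> ball z (\<epsilon> / 2)) ` D)"
      using D(2,3) by (auto simp: finite_open_cover_def openin_open_Int)
    fix V x y assume "V \<in> (\<lambda>z. X \<inter> ball z (\<epsilon> / 2)) ` D" "x \<in> V" "y \<in> V"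
    then obtain z where "dist z x < \<epsilon> / 2" "dist z y < \<epsilon> / 2" by auto
    then show "dist x y < \<epsilon>" using dist_triangle_half_r by blast
  qed
qed

text \<open>Identifies the index at which an increasing sequence of times has run through exactly a
  given finite stage.\<close>

lemma enumerate_initial_segment:
  fixes S :: "nat set"
  assumes S: "infinite S" and H: "H \<subseteq> S" "finite H" "\<And>h x. \<lbrakk>h \<in> H; x \<in> S - H\<rbrakk> \<Longrightarrow> h < x"
  shows "enumerate S ` {..<card H} = H"
proof -
  have mono: "strict_mono (enumerate S)" using S by (rule strict_mono_enumerate)
  have "H \<subseteq> enumerate S ` {..<card H}"
  proof
    fix h assume h: "h \<in> H"
    then obtain i where i: "enumerate S i = h" using enumerate_Ex[OF S, of h] h H(1) by blast
    have "enumerate S ` {..i} \<subseteq> H"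
    proof
      fix z assume "z \<in> enumerate S ` {..i}"
      then obtain l where l: "l \<le> i" "z = enumerate S l" by auto
      then have "z \<le> h" using i mono by (metis strict_mono_less_eq)
      then show "z \<in> H" using H(3)[OF h, of z] l(2) enumerate_in_set[OF S, of l] by fastforce
    qed
    then have "card (enumerate S ` {..i}) \<le> card H" using H(2) card_mono by blast
    then have "i < card H" using mono by (simp add: card_image strict_mono_imp_inj_on inj_on_subset[of _ UNIV])
    then show "h \<in> enumerate S ` {..<card H}" using i by blast
  qed
  moreover have "card (enumerate S ` {..<card H}) = card H"
    using mono by (simp add: card_image strict_mono_imp_inj_on inj_on_subset[of _ UNIV])
  ultimately show ?thesis by (metis card_subset_eq finite_imageI finite_lessThan)
qed

text \<open>Stages are concatenated, each adding times for a \<open>k\<close> larger than the number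
  of times used so far. After such a stage there are \<open>n \<le> k + q * k\<close> times while
  \<open>2 ^ k \<le> (N n)\<^sup>2\<close>, so the old times cannot dilute the growth rate.\<close>

lemma not_null_of_separated_pairs:
  fixes X :: "'a::metric_space set"
  assumes dyn: "dyn_system X T" and \<theta>: "\<theta> > 0"
    and pairs: "\<And>k m. \<exists>F P. finite F \<and> card F \<le> q * k \<and> (\<forall>t\<in>F. m \<le> t) \<and> P \<subseteq> X \<times> X \<and> card P = 2 ^ k \<and>
      (\<forall>p\<in>P. \<forall>p'\<in>P. p \<noteq> p' \<longrightarrow> (\<exists>t\<in>F.
        \<theta> \<le> \<bar>dist ((T ^^ t) (fst p)) ((T ^^ t) (snd p)) - dist ((T ^^ t) (fst p')) ((T ^^ t) (snd p'))\<bar>))"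
  shows "\<not> null_system X T"
proof
  assume null: "null_system X T"
  obtain F P where FP: "\<And>k m. finite (F k m)" "\<And>k m. card (F k m) \<le> q * k"
    "\<And>k m t. t \<in> F k m \<Longrightarrow> m \<le> t" "\<And>k m. P k m \<subseteq> X \<times> X" "\<And>k m. card (P k m) = 2 ^ k"
    and sep: "\<And>k m p p'. \<lbrakk>p \<in> P k m; p' \<in> P k m; p \<noteq> p'\<rbrakk> \<Longrightarrow> \<exists>t\<in>F k m.
      \<theta> \<le> \<bar>dist ((T ^^ t) (fst p)) ((T ^^ t) (snd p)) - dist ((T ^^ t) (fst p')) ((T ^^ t) (snd p'))\<bar>"
    using pairs by metis
  \<comment> \<open>For positive exponent there are at least two pairs, and telling them apart takes
    a time.\<close>
  have F_ne: "F (Suc k) m \<noteq> {}" for k m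
  proof
    assume e: "F (Suc k) m = {}"
    have "p = p'" if "p \<in> P (Suc k) m" "p' \<in> P (Suc k) m" for p p'
      using sep[OF that] e by auto
    then have "card (P (Suc k) m) \<le> 1" by (metis card_le_Suc0_iff_eq One_nat_def card.infinite zero_le)
    moreover have "(1::nat) < 2 ^ Suc k" by (rule one_less_power) auto
    ultimately show False using FP(5)[of "Suc k" m] by linarith
  qed
  \<comment> \<open>Inserting 0 makes \<open>Max\<close> meaningful for the empty stage;
    \<open>Suc\<close> makes new times strictly later than old ones.\<close>
  define next_time where "next_time h = Suc (Max (insert 0 h))" for h :: "nat set"
  define H where "H = rec_nat {} (\<lambda>_ h. h \<union> F (Suc (card h)) (next_time h))"
  have H0: "H 0 = {}" and HS: "H (Suc j) = H j \<union> F (Suc (card (H j))) (next_time (H j))" for j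
    by (simp_all add: H_def)
  have finH: "finite (H j)" for j by (induction j) (auto simp: H0 HS FP(1))
  have later: "h < x" if "h \<in> H j" "x \<in> F k (next_time (H j))" for h x j k
  proof -
    have "h \<le> Max (insert 0 (H j))" using that(1) finH by (intro Max_ge) auto
    then show ?thesis using FP(3)[OF that(2)] by (simp add: next_time_def)
  qed
  have monoH: "mono H" by (rule incseq_SucI) (simp add: HS)
  have segment: "h < x" if "h \<in> H j" "x \<in> H l" "x \<notin> H j" for h x j l
    using that(2,3)
  proof (induction l)
    case (Suc l)
    show ?case
    proof (cases "x \<in> H l")
      case False
      have "\<not> Suc l \<le> j" using Suc.prems monoH by (metis monoD subsetD)
      then have "h \<in> H l" using that(1) monoH by (metis monoD not_less_eq_eq subsetD)
      then show ?thesis using later Suc.prems(1) False HS by blast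
    qed (use Suc in auto)
  qed (simp add: H0)
  have card_H: "j \<le> card (H j)" for j
  proof (induction j)
    case (Suc j)
    obtain x where x: "x \<in> F (Suc (card (H j))) (next_time (H j))" using F_ne by blast
    have "x \<notin> H j" using later[of x j x] x by blast
    moreover have "insert x (H j) \<subseteq> H (Suc j)" using x HS by blast
    ultimately show ?case
      using Suc card_mono[OF finH[of "Suc j"], of "insert x (H j)"] finH by simp
  qed simp
  define S where "S = (\<Union>j. H j)"
  have S: "infinite S"
  proof
    assume "finite S"
    then have "card (H (Suc (card S))) \<le> card S" by (intro card_mono) (auto simp: S_def)
    then show False using card_H[of "Suc (card S)"] by simp
  qed
  define A where "A = enumerate S"
  have A: "A ` {..<card (H j)} = H j" for j
    unfolding A_def by (rule enumerate_initial_segment[OF S _ finH]) (auto simp: S_def segment)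
  obtain U where U: "finite_open_cover X U"
    "\<And>V x y. \<lbrakk>V \<in> U; x \<in> V; y \<in> V\<rbrakk> \<Longrightarrow> dist x y < \<theta> / 2"
    using exists_fine_finite_open_cover[of X "\<theta> / 2"] dyn \<theta> by (auto simp: dyn_system_def)
  define N where "N n = min_subcover X (join_cover X T A U n)" for n
  \<comment> \<open>The 2 comes from counting pairs by the square of \<open>N n\<close>, and
    \<open>real q + 1\<close> from \<open>n \<le> k + q * k\<close>.\<close>
  define c where "c = ln 2 / (2 * (real q + 1))"
  have c: "c > 0" by (simp add: c_def add_nonneg_pos)
  have large: "c \<le> ln (real (N (card (H (Suc j))))) / real (card (H (Suc j)))" for j
  proof -
    define k where "k = Suc (card (H j))"
    define n where "n = card (H (Suc j))"
    have "card (P k (next_time (H j))) \<le> (N n)\<^sup>2"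
      unfolding N_def
    proof (rule card_separated_pairs_le[OF dyn U FP(4)])
      fix p p' assume "p \<in> P k (next_time (H j))" "p' \<in> P k (next_time (H j))" "p \<noteq> p'"
      note sep[OF this]
      moreover have "F k (next_time (H j)) \<subseteq> A ` {..<n}" using A[of "Suc j"] HS by (simp add: n_def k_def)
      ultimately show "\<exists>t\<in>A ` {..<n}. \<theta> \<le> \<bar>dist ((T ^^ t) (fst p)) ((T ^^ t) (snd p)) -
          dist ((T ^^ t) (fst p')) ((T ^^ t) (snd p'))\<bar>" by (meson subsetD)
    qed
    then have N2: "2 ^ k \<le> (N n)\<^sup>2" by (simp add: FP(5))
    then have Npos: "N n > 0" by (cases "N n") auto
    have "real k * ln 2 = ln (2 ^ k)" by (simp add: ln_realpow)
    also have "\<dots> \<le> ln ((real (N n))\<^sup>2)"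
      using N2 Npos by (subst ln_le_cancel_iff) (simp_all flip: of_nat_power)
    also have "\<dots> = 2 * ln (real (N n))" using Npos by (simp add: ln_realpow)
    finally have lnN: "real k * ln 2 \<le> 2 * ln (real (N n))" .
    have "n \<le> card (H j) + card (F k (next_time (H j)))" by (simp add: n_def HS k_def card_Un_le)
    also have "\<dots> \<le> k + q * k" using FP(2)[of k "next_time (H j)"] by (simp add: k_def)
    finally have nk: "real n \<le> real k * (real q + 1)"
      by (simp add: algebra_simps flip: of_nat_mult of_nat_add)
    have n: "n > 0" using card_H[of "Suc j"] by (simp add: n_def)
    have "c * real n \<le> c * (real k * (real q + 1))" using nk c by (intro mult_left_mono) auto
    also have "\<dots> = real k * ln 2 / 2" by (simp add: c_def field_simps)
    also have "\<dots> \<le> ln (real (N n))" using lnN by simp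
    finally show ?thesis using n by (simp add: n_def pos_le_divide_eq)
  qed
  have "seq_entropy_cover X T A U \<le> seq_entropy X T A"
    unfolding seq_entropy_def using U(1) by (intro SUP_upper) simp
  also have "\<dots> = 0" using null S by (simp add: null_system_def A_def strict_mono_enumerate)
  also have "0 < ereal c" using c by simp
  finally have "limsup (\<lambda>n. ereal (ln (real (N n)) / real n)) < ereal c"
    by (simp add: seq_entropy_cover_def N_def)
  then have "\<forall>\<^sub>F n in sequentially. ereal (ln (real (N n)) / real n) < ereal c" by (rule Limsup_lessD)
  then obtain M where M: "\<And>n. n \<ge> M \<Longrightarrow> ln (real (N n)) / real n < c"
    by (auto simp: eventually_sequentially)
  \<comment> \<open>The stages have unbounded cardinality, so \<open>large\<close> contradicts the
    eventual bound at a stage beyond \<open>M\<close>.\<close>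
  show False using M[of "card (H (Suc M))"] card_H[of "Suc M"] large[of M] by simp
qed

section \<open>Zero-one patterns built by return times\<close>

text \<open>Pairs are indexed by their own pattern: along the times \<open>s 0, \<dots>, s (n - 1)\<close> the pair
  \<open>R B\<close> has ones exactly at the indices in \<open>B\<close>. The gap between \<open>\<theta>\<close> and \<open>2 * \<theta>\<close> makes distinct
  patterns metrically distinguishable.\<close>
definition realizes_patterns ::
  "('a::metric_space \<Rightarrow> 'a) \<Rightarrow> 'a set \<Rightarrow> real \<Rightarrow> nat \<Rightarrow> (nat \<Rightarrow> nat) \<Rightarrow>
    (nat set \<Rightarrow> 'a \<times> 'a) \<Rightarrow> nat set set \<Rightarrow> bool" where
  "realizes_patterns T Q \<theta> n s R \<B> \<longleftrightarrow>
     (\<forall>B\<in>\<B>. R B \<in> Q \<times> Q \<and>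
       (\<forall>i<n. let d = dist ((T ^^ s i) (fst (R B))) ((T ^^ s i) (snd (R B)))
              in if i \<in> B then 2 * \<theta> < d else d < \<theta>))"

lemma realizes_patternsD:
  assumes "realizes_patterns T Q \<theta> n s R \<B>" "B \<in> \<B>"
  shows "fst (R B) \<in> Q" "snd (R B) \<in> Q"
    "\<And>i. \<lbrakk>i < n; i \<in> B\<rbrakk> \<Longrightarrow> 2 * \<theta> < dist ((T ^^ s i) (fst (R B))) ((T ^^ s i) (snd (R B)))"
    "\<And>i. \<lbrakk>i < n; i \<notin> B\<rbrakk> \<Longrightarrow> dist ((T ^^ s i) (fst (R B))) ((T ^^ s i) (snd (R B))) < \<theta>"
  using assms by (auto simp: realizes_patterns_def Let_def)

lemma finite_positive_lower_bound:
  fixes f :: "'b \<Rightarrow> real"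
  assumes "finite A" "\<And>a. a \<in> A \<Longrightarrow> 0 < f a"
  obtains \<gamma> where "\<gamma> > 0" "\<And>a. a \<in> A \<Longrightarrow> \<gamma> \<le> f a"
proof -
  have "\<exists>\<gamma>>0. \<forall>a\<in>A. \<gamma> \<le> f a"
    using assms
  proof (induction A rule: finite_induct)
    case empty
    show ?case by (rule exI[of _ 1]) simp
  next
    case (insert a A)
    then obtain \<gamma> where \<gamma>: "\<gamma> > 0" "\<forall>x\<in>A. \<gamma> \<le> f x" by auto
    have "min \<gamma> (f a) > 0" using \<gamma>(1) insert.prems by simp
    then show ?case using \<gamma>(2) by (intro exI[of _ "min \<gamma> (f a)"]) auto
  qed
  then show ?thesis using that by blast
qed

text \<open>The patterns amount to finitely many strict inequalities, which leave a common slack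
  \<gamma>; moving both points of a pair by less than \<delta> changes the relevant distances by
  less than \<gamma>. It is meant for moving a pair by a return time.\<close>

lemma patterns_stable:
  fixes X :: "'a::metric_space set"
  assumes dyn: "dyn_system X T" and Q: "Q \<subseteq> X" and \<B>: "finite \<B>"
    and R: "realizes_patterns T Q \<theta> n s R \<B>"
  obtains \<delta> where "\<delta> > 0"
    "\<And>B i x y. \<lbrakk>B \<in> \<B>; i < n; x \<in> X; y \<in> X; dist x (fst (R B)) < \<delta>; dist y (snd (R B)) < \<delta>\<rbrakk> \<Longrightarrow>
      (let d = dist ((T ^^ s i) x) ((T ^^ s i) y) in if i \<in> B then 2 * \<theta> < d else d < \<theta>)"
proof -
  let ?g = "\<lambda>i p. dist ((T ^^ s i) (fst p)) ((T ^^ s i) (snd p))"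
  define slack where "slack p = (case p of (B, i) \<Rightarrow>
    if i \<in> B then ?g i (R B) - 2 * \<theta> else \<theta> - ?g i (R B))" for p
  have "finite (\<B> \<times> {..<n})" using \<B> by simp
  moreover have "0 < slack p" if "p \<in> \<B> \<times> {..<n}" for p
    using that realizes_patternsD[OF R] by (auto simp: slack_def split: prod.split)
  ultimately obtain \<gamma> where \<gamma>: "\<gamma> > 0" "\<And>p. p \<in> \<B> \<times> {..<n} \<Longrightarrow> \<gamma> \<le> slack p"
    using finite_positive_lower_bound by metis
  obtain L where L: "\<And>i. i < n \<Longrightarrow> s i < L"
    using finite_nat_set_iff_bounded[THEN iffD1, of "s ` {..<n}"] by auto
  obtain \<delta> where \<delta>: "\<delta> > 0" "\<And>x y t. \<lbrakk>x \<in> X; y \<in> X; dist x y < \<delta>; t < L\<rbrakk> \<Longrightarrow>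
      dist ((T ^^ t) x) ((T ^^ t) y) < \<gamma> / 2"
    using finite_time_shadowing[OF dyn, of "\<gamma> / 2" L] \<gamma>(1) by auto
  show ?thesis
  proof (rule that[OF \<delta>(1)])
    fix B i x y assume h: "B \<in> \<B>" "i < n" "x \<in> X" "y \<in> X"
      "dist x (fst (R B)) < \<delta>" "dist y (snd (R B)) < \<delta>"
    have "fst (R B) \<in> X" "snd (R B) \<in> X" using realizes_patternsD(1,2)[OF R h(1)] Q by auto
    then have "dist ((T ^^ s i) x) ((T ^^ s i) (fst (R B))) < \<gamma> / 2"
      "dist ((T ^^ s i) y) ((T ^^ s i) (snd (R B))) < \<gamma> / 2"
      using \<delta>(2) h L by auto
    then have "\<bar>?g i (x, y) - ?g i (R B)\<bar> < \<gamma>"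
      using abs_dist_diff_le[of "(T ^^ s i) x" "(T ^^ s i) y" "(T ^^ s i) (fst (R B))" "(T ^^ s i) (snd (R B))"]
      by simp
    moreover have "\<gamma> \<le> slack (B, i)" using \<gamma>(2) h(1,2) by simp
    ultimately show "let d = dist ((T ^^ s i) x) ((T ^^ s i) y) in if i \<in> B then 2 * \<theta> < d else d < \<theta>"
      by (auto simp: slack_def Let_def split: if_splits)
  qed
qed

text \<open>Pigeonhole after double counting the pairs \<open>(a, i)\<close> with
  \<open>P i a\<close>.\<close>

lemma exists_index_card_ge:
  assumes "finite A" "finite I" and ge: "\<And>i. i \<in> I \<Longrightarrow> c \<le> card {a \<in> A. P i a}"
    and A: "card A * k \<le> card I * c" "A \<noteq> {}"
  obtains a where "a \<in> A" "k \<le> card {i \<in> I. P i a}"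
proof -
  have "\<exists>a\<in>A. k \<le> card {i \<in> I. P i a}"
  proof (rule ccontr)
    assume "\<not> ?thesis"
    then have "(\<Sum>a\<in>A. card {i \<in> I. P i a}) < (\<Sum>a\<in>A. k)"
      using assms(1) A(2) by (intro sum_strict_mono) auto
    moreover have "(\<Sum>a\<in>A. card {i \<in> I. P i a}) = (\<Sum>i\<in>I. card {a \<in> A. P i a})"
      using assms(1,2) by (intro sum_multicount_gen) auto
    moreover have "(\<Sum>i\<in>I. c) \<le> (\<Sum>i\<in>I. card {a \<in> A. P i a})" by (rule sum_mono) (rule ge)
    ultimately show False using A(1) by simp
  qed
  then show ?thesis using that by blast
qed

text \<open>The old pairs fix \<delta> and the return gap \<open>G\<close> before the new pair is
  chosen. Only indices in the new pattern \<open>B\<close> are moved, by common return times of the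
  old pairs, so old patterns survive.\<close>

lemma extend_patterns:
  fixes X :: "'a::metric_space set"
  assumes dyn: "dyn_system X T" and Q: "Q \<subseteq> X" "T ` Q \<subseteq> Q"
    and rec: "\<forall>E\<subseteq>Q. finite E \<longrightarrow> jointly_recurrent T E"
    and \<theta>: "\<theta> > 0"
    and blocks: "\<forall>m. \<forall>G>0. \<exists>x\<in>Q. \<exists>y\<in>Q. (\<forall>t<m. dist ((T ^^ t) x) ((T ^^ t) y) < \<theta>) \<and>
       (\<exists>b. 2 * G \<le> q * card {t \<in> {b..<b + G}. 2 * \<theta> < dist ((T ^^ t) x) ((T ^^ t) y)})"
    and \<B>: "finite \<B>" "card \<B> < 2 ^ k"
    and R: "realizes_patterns T Q \<theta> (q * k) s R \<B>" and s: "\<And>i. m \<le> s i"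
  obtains B s' R' where "B \<subseteq> {..<q * k}" "B \<notin> \<B>"
    "realizes_patterns T Q \<theta> (q * k) s' R' (insert B \<B>)" "\<And>i. m \<le> s' i"
proof -
  define n where "n = q * k"
  note R = R[folded n_def]
  obtain \<delta> where \<delta>: "\<delta> > 0"
    "\<And>B i x y. \<lbrakk>B \<in> \<B>; i < n; x \<in> X; y \<in> X; dist x (fst (R B)) < \<delta>; dist y (snd (R B)) < \<delta>\<rbrakk> \<Longrightarrow>
      (let d = dist ((T ^^ s i) x) ((T ^^ s i) y) in if i \<in> B then 2 * \<theta> < d else d < \<theta>)"
    using patterns_stable[OF dyn Q(1) \<B>(1) R] by blast
  define E where "E = (fst \<circ> R) ` \<B> \<union> (snd \<circ> R) ` \<B>"
  have "finite E" "E \<subseteq> Q" using \<B>(1) realizes_patternsD(1,2)[OF R] by (auto simp: E_def)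
  then obtain G where G: "\<And>b. \<exists>\<tau>. b \<le> \<tau> \<and> \<tau> < b + G \<and> (\<forall>x\<in>E. dist ((T ^^ \<tau>) x) x < \<delta>)"
    using rec \<delta>(1) unfolding jointly_recurrent_def by meson
  have "G > 0" using G[of 0] by auto
  obtain L where L: "\<And>i. i < n \<Longrightarrow> s i < L"
    using finite_nat_set_iff_bounded[THEN iffD1, of "s ` {..<n}"] by auto
  \<comment> \<open>Shifts stay below \<open>2 * G\<close> and unmoved times below \<open>L\<close>,
    so zeros of length \<open>2 * G + L\<close> make every unmoved index a zero of the shifted
    pair.\<close>
  obtain x y b where xy: "x \<in> Q" "y \<in> Q"
    and zero: "\<And>t. t < 2 * G + L \<Longrightarrow> dist ((T ^^ t) x) ((T ^^ t) y) < \<theta>"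
    and b: "2 * G \<le> q * card {t \<in> {b..<b + G}. 2 * \<theta> < dist ((T ^^ t) x) ((T ^^ t) y)}"
    using blocks[rule_format, OF \<open>G > 0\<close>, of "2 * G + L"] by blast
  define E0 where "E0 = {t \<in> {b..<b + G}. 2 * \<theta> < dist ((T ^^ t) x) ((T ^^ t) y)}"
  note b = b[folded E0_def]
  \<comment> \<open>The window of ones lies beyond the initial zeros, so there is room for a return time that
    moves \<open>s i\<close> to just before it.\<close>
  have "E0 \<noteq> {}" using b \<open>G > 0\<close> by auto
  then obtain t0 where t0: "t0 < b + G" "2 * \<theta> < dist ((T ^^ t0) x) ((T ^^ t0) y)"
    by (auto simp: E0_def)
  then have "2 * G + L \<le> t0" using zero[of t0] \<theta> by (cases "t0 < 2 * G + L") auto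
  then have bL: "G + L \<le> b" using t0(1) by simp
  have "\<exists>\<tau>. b - G \<le> s i + \<tau> \<and> s i + \<tau> < b \<and> (\<forall>x\<in>E. dist ((T ^^ \<tau>) x) x < \<delta>)" if i: "i < n" for i
  proof -
    obtain \<tau> where \<tau>: "b - G - s i \<le> \<tau>" "\<tau> < b - G - s i + G" "\<forall>x\<in>E. dist ((T ^^ \<tau>) x) x < \<delta>"
      using G by blast
    then show ?thesis using bL L[OF i] by (intro exI[of _ \<tau>]) auto
  qed
  then obtain \<tau> where \<tau>: "\<And>i. i < n \<Longrightarrow> b - G \<le> s i + \<tau> i" "\<And>i. i < n \<Longrightarrow> s i + \<tau> i < b"
    "\<And>i x. \<lbrakk>i < n; x \<in> E\<rbrakk> \<Longrightarrow> dist ((T ^^ \<tau> i) x) x < \<delta>" by metis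
  define good where "good i a \<longleftrightarrow>
    2 * \<theta> < dist ((T ^^ (s i + \<tau> i + a)) x) ((T ^^ (s i + \<tau> i + a)) y)" for i a
  \<comment> \<open>The moved time lies in \<open>[b - G, b)\<close> and the window in
    \<open>[b, b + G)\<close>, so every one in \<open>E0\<close> is reached by a shift below
    \<open>2 * G\<close>.\<close>
  have "card E0 \<le> card {a \<in> {..<2 * G}. good i a}" if i: "i \<in> {..<n}" for i
  proof (rule card_inj_on_le[of "\<lambda>t. t - (s i + \<tau> i)"])
    have lt: "s i + \<tau> i \<le> t" if "t \<in> E0" for t using \<tau>(2)[of i] i that by (auto simp: E0_def)
    show "inj_on (\<lambda>t. t - (s i + \<tau> i)) E0"
      by (rule inj_onI) (metis lt le_add_diff_inverse)
    show "(\<lambda>t. t - (s i + \<tau> i)) ` E0 \<subseteq> {a \<in> {..<2 * G}. good i a}"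
    proof
      fix a assume "a \<in> (\<lambda>t. t - (s i + \<tau> i)) ` E0"
      then obtain t where t: "t \<in> E0" "a = t - (s i + \<tau> i)" by auto
      then have "t = s i + \<tau> i + a" using lt by simp
      moreover have "t < b + G" using t(1) by (simp add: E0_def)
      ultimately show "a \<in> {a \<in> {..<2 * G}. good i a}"
        using t(1) \<tau>(1)[of i] i by (auto simp: good_def E0_def)
    qed
  qed simp
  \<comment> \<open>The factor 2 in the density of ones pays for the \<open>2 * G\<close>
    shifts.\<close>
  moreover have "card {..<2 * G} * k \<le> card {..<n} * card E0"
    using mult_right_mono[OF b, of k] by (simp add: n_def mult.commute mult.left_commute)
  moreover have "{..<2 * G} \<noteq> {}" using \<open>G > 0\<close> by (simp add: lessThan_empty_iff)
  ultimately obtain a where "a \<in> {..<2 * G}" and a2: "k \<le> card {i \<in> {..<n}. good i a}"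
    by (rule exists_index_card_ge[OF finite_lessThan finite_lessThan])
  then have a: "a < 2 * G" by simp
  define I where "I = {i \<in> {..<n}. good i a}"
  \<comment> \<open>\<open>I\<close> has at least \<open>2 ^ k\<close> subsets, more than there are
    old patterns, so one of them is new.\<close>
  have "(2::nat) ^ k \<le> 2 ^ card I" using a2 unfolding I_def by (intro power_increasing) auto
  with \<B>(2) have "card \<B> < 2 ^ card I" by (rule less_le_trans)
  then have "card \<B> < card (Pow I)" by (simp add: card_Pow I_def)
  then obtain B where B: "B \<subseteq> I" "B \<notin> \<B>" using card_mono[OF \<B>(1), of "Pow I"] by auto
  define s' where "s' i = (if i \<in> B then s i + \<tau> i else s i)" for i
  define R' where "R' = R(B := ((T ^^ a) x, (T ^^ a) y))"
  show ?thesis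
  proof
    show "B \<subseteq> {..<q * k}" using B(1) by (auto simp: I_def n_def)
    show "B \<notin> \<B>" by (rule B)
    show "m \<le> s' i" for i using s[of i] by (simp add: s'_def)
    have "R' B \<in> Q \<times> Q" using funpow_invariant[OF Q(2)] xy by (simp add: R'_def)
    moreover have "let d = dist ((T ^^ s' i) (fst (R' B))) ((T ^^ s' i) (snd (R' B)))
      in if i \<in> B then 2 * \<theta> < d else d < \<theta>" if "i < n" for i
    proof (cases "i \<in> B")
      case True
      then have "good i a" using B(1) by (auto simp: I_def)
      then show ?thesis using True by (simp add: good_def s'_def R'_def funpow_add)
    next
      case False
      have "s i + a < 2 * G + L" using L[OF that] a by simp
      then show ?thesis using False zero[of "s i + a"] by (simp add: s'_def R'_def funpow_add)
    qed
    moreover have "R' B' \<in> Q \<times> Q" if "B' \<in> \<B>" for B'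
      using that B(2) realizes_patternsD(1,2)[OF R that] by (auto simp: R'_def mem_Times_iff)
    moreover have "let d = dist ((T ^^ s' i) (fst (R' B'))) ((T ^^ s' i) (snd (R' B')))
      in if i \<in> B' then 2 * \<theta> < d else d < \<theta>" if B': "B' \<in> \<B>" and i: "i < n" for B' i
    proof -
      \<comment> \<open>For an unmoved index 0 serves as a trivial return time, so both cases are
        handled alike.\<close>
      define \<sigma> where "\<sigma> = (if i \<in> B then \<tau> i else 0)"
      have s': "s' i = s i + \<sigma>" by (simp add: s'_def \<sigma>_def)
      have R': "R' B' = R B'" using B' B(2) by (auto simp: R'_def)
      have "fst (R B') \<in> E" "snd (R B') \<in> E" using B' by (auto simp: E_def)
      then have "dist ((T ^^ \<sigma>) (fst (R B'))) (fst (R B')) < \<delta>"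
        "dist ((T ^^ \<sigma>) (snd (R B'))) (snd (R B')) < \<delta>"
        using \<tau>(3) i \<delta>(1) by (auto simp: \<sigma>_def)
      moreover have "(T ^^ \<sigma>) (fst (R B')) \<in> X" "(T ^^ \<sigma>) (snd (R B')) \<in> X"
        using funpow_invariant[OF Q(2)] realizes_patternsD(1,2)[OF R B'] Q(1) by auto
      ultimately show ?thesis using \<delta>(2)[OF B' i] by (simp add: s' R' funpow_add)
    qed
    ultimately show "realizes_patterns T Q \<theta> (q * k) s' R' (insert B \<B>)"
      by (auto simp: realizes_patterns_def n_def)
  qed
qed

text \<open>Patterns are added one at a time. Each addition replaces the times and the pairs, so
  \<open>s\<close> and \<open>R\<close> are quantified inside the induction.\<close>

lemma exists_many_patterns:
  fixes X :: "'a::metric_space set"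
  assumes dyn: "dyn_system X T" and Q: "Q \<subseteq> X" "T ` Q \<subseteq> Q"
    and rec: "\<forall>E\<subseteq>Q. finite E \<longrightarrow> jointly_recurrent T E"
    and \<theta>: "\<theta> > 0"
    and blocks: "\<forall>m. \<forall>G>0. \<exists>x\<in>Q. \<exists>y\<in>Q. (\<forall>t<m. dist ((T ^^ t) x) ((T ^^ t) y) < \<theta>) \<and>
       (\<exists>b. 2 * G \<le> q * card {t \<in> {b..<b + G}. 2 * \<theta> < dist ((T ^^ t) x) ((T ^^ t) y)})"
  obtains \<B> s R where "\<B> \<subseteq> Pow {..<q * k}" "card \<B> = 2 ^ k"
    "realizes_patterns T Q \<theta> (q * k) s R \<B>" "\<forall>i. m \<le> s i"
proof -
  have "\<exists>\<B> s R. \<B> \<subseteq> Pow {..<q * k} \<and> card \<B> = j \<and>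
      realizes_patterns T Q \<theta> (q * k) s R \<B> \<and> (\<forall>i. m \<le> s i)" if "j \<le> 2 ^ k" for j
    using that
  proof (induction j)
    case 0
    show ?case
      by (intro exI[of _ "{}"] exI[of _ "\<lambda>_. m"]) (simp add: realizes_patterns_def)
  next
    case (Suc j)
    then obtain \<B> s R where IH: "\<B> \<subseteq> Pow {..<q * k}" "card \<B> = j"
      "realizes_patterns T Q \<theta> (q * k) s R \<B>" "\<And>i. m \<le> s i" by auto
    have fin: "finite \<B>" using IH(1) finite_subset by blast
    have "card \<B> < 2 ^ k" using Suc.prems IH(2) by simp
    from extend_patterns[OF dyn Q rec \<theta> blocks fin this IH(3,4)]
    obtain B s' R' where "B \<subseteq> {..<q * k}" "B \<notin> \<B>"
      "realizes_patterns T Q \<theta> (q * k) s' R' (insert B \<B>)" "\<And>i. m \<le> s' i" by blast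
    then show ?case
      using IH(1,2) fin by (intro exI[of _ "insert B \<B>"] exI[of _ s'] exI[of _ R']) auto
  qed
  then show ?thesis using that by blast
qed

section \<open>Positive sequence entropy from the patterns\<close>

theorem mainTheorem8:
  fixes X :: "'a::metric_space set" and T :: "'a \<Rightarrow> 'a"
  assumes "dyn_system X T"
    and "null_system X T"
    and "X \<subseteq> closure {y \<in> X. minimal_point T y}"
  shows "mean_equicontinuous X T"
proof (rule ccontr)
  assume not_me: "\<not> mean_equicontinuous X T"
  obtain Q where Q: "Q \<subseteq> X" "T ` Q \<subseteq> Q" "X \<subseteq> closure Q"
    and rec: "\<forall>E\<subseteq>Q. finite E \<longrightarrow> jointly_recurrent T E"
    by (rule dense_jointly_recurrent[OF assms(1,3)])
  obtain \<theta> q where \<theta>: "\<theta> > 0" and blocks: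
    "\<forall>m. \<forall>G>0. \<exists>x\<in>Q. \<exists>y\<in>Q. (\<forall>t<m. dist ((T ^^ t) x) ((T ^^ t) y) < \<theta>) \<and>
       (\<exists>b. 2 * G \<le> q * card {t \<in> {b..<b + G}. 2 * \<theta> < dist ((T ^^ t) x) ((T ^^ t) y)})"
    by (rule not_mean_equicontinuous_blocks[OF assms(1) Q(1,3) not_me])
  have "\<not> null_system X T"
  proof (rule not_null_of_separated_pairs[OF assms(1) \<theta>])
    fix k m
    obtain \<B> s R where \<B>: "\<B> \<subseteq> Pow {..<q * k}" "card \<B> = 2 ^ k"
      and R: "realizes_patterns T Q \<theta> (q * k) s R \<B>" and s: "\<forall>i. m \<le> s i"
      by (rule exists_many_patterns[OF assms(1) Q(1,2) rec \<theta> blocks])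
    have sep: "\<exists>t\<in>s ` {..<q * k}. \<theta> \<le> \<bar>dist ((T ^^ t) (fst (R B))) ((T ^^ t) (snd (R B))) -
        dist ((T ^^ t) (fst (R B'))) ((T ^^ t) (snd (R B')))\<bar>"
      if h: "B \<in> \<B>" "B' \<in> \<B>" "B \<noteq> B'" for B B'
    proof -
      \<comment> \<open>Both patterns lie below \<open>q * k\<close>, so they differ at an observed
        index; there one distance exceeds 2\<theta> and the other is below \<theta>.\<close>
      have "\<exists>i<q * k. i \<in> B \<longleftrightarrow> i \<notin> B'" using \<B>(1) h by blast
      then obtain i where i: "i < q * k" "i \<in> B \<longleftrightarrow> i \<notin> B'" by blast
      show ?thesis
      proof (rule bexI[of _ "s i"])
        show "\<theta> \<le> \<bar>dist ((T ^^ s i) (fst (R B))) ((T ^^ s i) (snd (R B))) -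
            dist ((T ^^ s i) (fst (R B'))) ((T ^^ s i) (snd (R B')))\<bar>"
          using realizes_patternsD(3,4)[OF R h(1) i(1)] realizes_patternsD(3,4)[OF R h(2) i(1)] i(2)
          by (cases "i \<in> B"; cases "i \<in> B'") linarith+
      qed (use i in auto)
    qed
    \<comment> \<open>Equal pairs have equal distances at every time, which \<open>sep\<close>
      excludes for different patterns.\<close>
    have "inj_on R \<B>"
    proof (rule inj_onI, rule ccontr)
      fix B B' assume "B \<in> \<B>" "B' \<in> \<B>" "R B = R B'" "B \<noteq> B'"
      then show False using sep[of B B'] \<theta> by auto
    qed
    then have "card (R ` \<B>) = 2 ^ k" using \<B>(2) by (simp add: card_image)
    \<comment> \<open>Only an inequality is claimed, since the times \<open>s i\<close> may
      coincide.\<close>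
    moreover have "card (s ` {..<q * k}) \<le> q * k" by (metis card_image_le card_lessThan finite_lessThan)
    moreover have "R ` \<B> \<subseteq> X \<times> X" 
      using realizes_patternsD(1,2)[OF R] Q(1) by (intro image_subsetI) (auto simp: mem_Times_iff)
    moreover have "\<forall>p\<in>R ` \<B>. \<forall>p'\<in>R ` \<B>. p \<noteq> p' \<longrightarrow> (\<exists>t\<in>s ` {..<q * k}.
        \<theta> \<le> \<bar>dist ((T ^^ t) (fst p)) ((T ^^ t) (snd p)) - dist ((T ^^ t) (fst p')) ((T ^^ t) (snd p'))\<bar>)"
    proof (intro ballI impI)
      fix p p' assume "p \<in> R ` \<B>" "p' \<in> R ` \<B>" "p \<noteq> p'"
      then obtain B B' where "B \<in> \<B>" "B' \<in> \<B>" "B \<noteq> B'" "p = R B" "p' = R B'" by blast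
      then show "\<exists>t\<in>s ` {..<q * k}.
        \<theta> \<le> \<bar>dist ((T ^^ t) (fst p)) ((T ^^ t) (snd p)) - dist ((T ^^ t) (fst p')) ((T ^^ t) (snd p'))\<bar>"
        using sep by metis
    qed
    ultimately show "\<exists>F P. finite F \<and> card F \<le> q * k \<and> (\<forall>t\<in>F. m \<le> t) \<and> P \<subseteq> X \<times> X \<and> card P = 2 ^ k \<and>
      (\<forall>p\<in>P. \<forall>p'\<in>P. p \<noteq> p' \<longrightarrow> (\<exists>t\<in>F.
        \<theta> \<le> \<bar>dist ((T ^^ t) (fst p)) ((T ^^ t) (snd p)) - dist ((T ^^ t) (fst p')) ((T ^^ t) (snd p'))\<bar>))"
      using s by (intro exI[of _ "s ` {..<q * k}"] exI[of _ "R ` \<B>"]) simp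
  qed
  then show False using assms(2) by blast
qed

end
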